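(* Let $T$ be a finite tree, $xy\in E(T)$, and let $T^{(\ell)}$, $R_A$, $R_B$, $\Phi_A$, $\Phi_B$ be as defined in the context. Let $\lambda\in\mathbb R$ with $\lambda\notin\sigma(R_A)\cup\sigma(R_B)$, and abbreviate $\Phi_A=\Phi_A(\lambda)$, $\Phi_B=\Phi_B(\lambda)$. (i) For every $\ell\ge 2$, any eigenvector of $R_{T^{(\ell)}}$ with eigenvalue $\lambda$ and chain coordinates $z_1,\dots,z_\ell$ satisfies $z_2=\Phi_A z_1$, $z_{\ell-1}=\Phi_B z_\ell$, and $z_{j-1}+z_{j+1}=2(1+\lambda)z_j$ for $2\le j\le \ell-1$. (ii) For the unsubdivided tree, $$\lambda\in\sigma(R_{T^{(1)}})=\sigma(R_T)\iff D_1(\lambda):=2(1+\lambda)-\Phi_A-\Phi_B=0.$$ (iii) For every $\ell\ge 2$, with $M(\lambda)=\begin{pmatrix}2(1+\lambda)&-1\\1&0\end{pmatrix}$, $$\lambda\in\sigma(R_{T^{(\ell)}})\iff D_\ell(\lambda):=\begin{pmatrix}-\Phi_B&1\end{pmatrix}M(\lambda)^{\ell-2}\begin{pmatrix}\Phi_A\\1\end{pmatrix}=0,$$ and $$D_\ell(\lambda)=-\Phi_A\Phi_B\,U_{\ell-2}(1+\lambda)+(\Phi_A+\Phi_B)\,U_{\ell-3}(1+\lambda)-U_{\ell-4}(1+\lambda).$$ In particular, $D_2(\lambda)=1-\Phi_A\Phi_B$ and $D_3(\lambda)=\Phi_A+\Phi_B-2(1+\lambda)\Phi_A\Phi_B$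.
   Context: For a finite tree $T=(V,E)$ let $d_z$ denote the degree of the vertex $z$. The Ricci matrix $R_T\in\mathbb R^{E\times E}$ is the real symmetric matrix indexed by edges with entries $(R_T)_{e,e}=-\left(\frac1{d_x}+\frac1{d_y}\right)$ for $e=\{x,y\}$, $(R_T)_{e,e'}=\frac1{d_z}$ if $e\ne e'$ and $e\cap e'=\{z\}$, and $(R_T)_{e,e'}=0$ if $e\cap e'=\varnothing$. $\sigma(M)$ denotes the spectrum of $M$. Fix an edge $xy\in E(T)$. For $\ell\ge 2$, $T^{(\ell)}$ is obtained from $T$ by replacing $xy$ with a path $x=v_0-v_1-\cdots-v_{\ell-1}-v_\ell=y$ of length $\ell$ through new vertices $v_1,\dots,v_{\ell-1}$ of degree $2$; $T^{(1)}:=T$. The chain edges are $e_j=v_{j-1}v_j$, $1\le j\le\ell$, and for an edge vector $\mathbf w$ its chain coordinates are $z_j:=\mathbf w(e_j)$. Deleting $xy$ from $T$ leaves two rooted branches: $A$ (containing the root $x$) and $B$ (containing the root $y$), with edge sets $E(A),E(B)$. $R_A$ and $R_B$ are the principal submatrices of $R_T$ on $E(A)$ and $E(B)$ (all degrees are those in $T$). Let $s_A\in\mathbb R^{E(A)}$ be the indicator vector of the $d_x-1$ edges of $A$ incident to $x$, let $s_B\in\mathbb R^{E(B)}$ be the indicator vector of the $d_y-1$ edges of $B$ incident to $y$, and put $c_A=\frac1{d_x}s_A$, $c_B=\frac1{d_y}s_B$. For $\lambda\notin\sigma(R_A)\cup\sigma(R_B)$ the feedback functions are $$\Phi_A(\lambda)=2\left(\lambda+\tfrac1{d_x}+\tfrac12-c_A^{T}(\lambda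 I-R_A)^{-1}c_A\right),\qquad \Phi_B(\lambda)=2\left(\lambda+\tfrac1{d_y}+\tfrac12-c_B^{T}(\lambda I-R_B)^{-1}c_B\right).$$ (If a branch has no edges, its spectrum is empty and the corresponding quadratic term is $0$.) $U_n$ are the Chebyshev polynomials of the second kind, extended to negative indices: $U_{-2}(c)=-1$, $U_{-1}(c)=0$, $U_0(c)=1$, $U_{n+1}(c)=2c\,U_n(c)-U_{n-1}(c)$. *)

theory Defs
  imports Complex_Main "Jordan_Normal_Form.Matrix"
begin

section \<open>Finite trees\<close>

type_synonym 'a ugraph = "'a set \<times> 'a set set"

abbreviation verts :: "'a ugraph \<Rightarrow> 'a set" where "verts \<equiv> fst"
abbreviation edges :: "'a ugraph \<Rightarrow> 'a set set" where "edges \<equiv> snd"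

definition finite_simple_graph :: "'a ugraph \<Rightarrow> bool" where
  "finite_simple_graph T \<longleftrightarrow>
     finite (verts T) \<and> (\<forall>e \<in> edges T. e \<subseteq> verts T \<and> card e = 2)"

definition adj :: "'a set set \<Rightarrow> ('a \<times> 'a) set" where
  "adj E = {(u, v). {u, v} \<in> E}"

definition connected_graph :: "'a ugraph \<Rightarrow> bool" where
  "connected_graph T \<longleftrightarrow>
     verts T \<noteq> {} \<and> (\<forall>u \<in> verts T. \<forall>v \<in> verts T. (u, v) \<in> (adj (edges T))\<^sup>*)"

definition is_cycle :: "'a ugraph \<Rightarrow> 'a list \<Rightarrow> bool" where
  "is_cycle T p \<longleftrightarrow>
     3 \<le> length p \<and> distinct p \<and>
     (\<forall>i < length p. {p ! i, p ! (Suc i mod length p)} \<in> edges T)"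

definition finite_tree :: "'a ugraph \<Rightarrow> bool" where
  "finite_tree T \<longleftrightarrow>
     finite_simple_graph T \<and> connected_graph T \<and> (\<nexists>p. is_cycle T p)"

definition vdegree :: "'a ugraph \<Rightarrow> 'a \<Rightarrow> nat" where
  "vdegree T z = card {e \<in> edges T. z \<in> e}"


section \<open>Real matrices indexed by a finite set\<close>

text \<open>A matrix with rows and columns indexed by a finite set \<open>I\<close> is a function
  \<open>M :: 'i \<Rightarrow> 'i \<Rightarrow> real\<close> used together with \<open>I\<close>; only its values on \<open>I \<times> I\<close> matter. In
  particular the principal submatrix of \<open>M\<close> on \<open>J \<subseteq> I\<close> is \<open>M\<close> together with \<open>J\<close>. Vectors
  are treated in the same way.\<close>

definition eigenvector_on :: "'i set \<Rightarrow> ('i \<Rightarrow> 'i \<Rightarrow> real) \<Rightarrow> real \<Rightarrow> ('i \<Rightarrow> real) \<Rightarrow> bool" where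
  "eigenvector_on I M lam w \<longleftrightarrow>
     (\<exists>i \<in> I. w i \<noteq> 0) \<and> (\<forall>i \<in> I. (\<Sum>j \<in> I. M i j * w j) = lam * w i)"

text \<open>Only real eigenvalues are collected; for the symmetric matrices considered here there
  are no others.\<close>

definition spectrum_on :: "'i set \<Rightarrow> ('i \<Rightarrow> 'i \<Rightarrow> real) \<Rightarrow> real set" where
  "spectrum_on I M = {lam. \<exists>w. eigenvector_on I M lam w}"

definition identity_on :: "'i \<Rightarrow> 'i \<Rightarrow> real" where
  "identity_on i j = (if i = j then 1 else 0)"

definition inverts_on :: "'i set \<Rightarrow> ('i \<Rightarrow> 'i \<Rightarrow> real) \<Rightarrow> ('i \<Rightarrow> 'i \<Rightarrow> real) \<Rightarrow> bool" where
  "inverts_on I M N \<longleftrightarrow>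
     (\<forall>i \<in> I. \<forall>j \<in> I. (\<Sum>k \<in> I. M i k * N k j) = identity_on i j \<and>
                     (\<Sum>k \<in> I. N i k * M k j) = identity_on i j)"

definition inverse_on :: "'i set \<Rightarrow> ('i \<Rightarrow> 'i \<Rightarrow> real) \<Rightarrow> 'i \<Rightarrow> 'i \<Rightarrow> real" where
  "inverse_on I M = (SOME N. inverts_on I M N)"


section \<open>Ricci matrix and subdivision\<close>

text \<open>For distinct edges \<open>e\<close>, \<open>f\<close> of a simple graph, \<open>e \<inter> f\<close> has at most one element \<open>z\<close>, so the
  second sum is \<open>1 / d\<^sub>z\<close> or \<open>0\<close>.\<close>

definition ricci :: "'a ugraph \<Rightarrow> 'a set \<Rightarrow> 'a set \<Rightarrow> real" where
  "ricci T e f =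
     (if e = f then - (\<Sum>z \<in> e. 1 / real (vdegree T z))
      else (\<Sum>z \<in> e \<inter> f. 1 / real (vdegree T z)))"

text \<open>The new vertices of a subdivision are an arbitrary choice of distinct vertices outside
  the graph, given as the values of \<open>v\<close> at \<open>1, \<dots>, l - 1\<close>.\<close>

definition subdividing_path :: "'a ugraph \<Rightarrow> 'a \<Rightarrow> 'a \<Rightarrow> nat \<Rightarrow> (nat \<Rightarrow> 'a) \<Rightarrow> bool" where
  "subdividing_path T x y l v \<longleftrightarrow>
     v 0 = x \<and> v l = y \<and> inj_on v {1..<l} \<and> v ` {1..<l} \<inter> verts T = {}"

definition chain_edge :: "(nat \<Rightarrow> 'a) \<Rightarrow> nat \<Rightarrow> 'a set" where
  "chain_edge v j = {v (j - 1), v j}"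

definition subdivide :: "'a ugraph \<Rightarrow> 'a \<Rightarrow> 'a \<Rightarrow> nat \<Rightarrow> (nat \<Rightarrow> 'a) \<Rightarrow> 'a ugraph" where
  "subdivide T x y l v =
     (verts T \<union> v ` {1..<l}, (edges T - {{x, y}}) \<union> chain_edge v ` {1..l})"

lemma subdivide_1:
  assumes "subdividing_path T x y 1 v" and "{x, y} \<in> edges T"
  shows "subdivide T x y 1 v = T"
  using assms by (cases T) (auto simp: subdividing_path_def subdivide_def chain_edge_def)

lemma subdividing_path_exists:
  fixes T :: "'a ugraph"
  assumes "infinite (UNIV :: 'a set)" and "finite (verts T)" and "l \<ge> 1"
  shows "\<exists>v. subdividing_path T x y l v"
proof -
  have "infinite (UNIV - verts T)"
    using assms by (simp add: Diff_infinite_finite)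
  then obtain g :: "nat \<Rightarrow> 'a" where g: "inj g" "range g \<subseteq> UNIV - verts T"
    using infinite_countable_subset by blast
  define v where "v i = (if i = 0 then x else if i = l then y else g i)" for i
  have "inj_on v {1..<l}"
    using g(1) by (auto simp: inj_on_def v_def)
  moreover have "v ` {1..<l} \<inter> verts T = {}"
    using g(2) by (auto simp: v_def)
  ultimately have "subdividing_path T x y l v"
    using assms(3) by (simp add: subdividing_path_def v_def)
  then show ?thesis by blast
qed


section \<open>Branches and feedback functions\<close>

text \<open>Edges of the component of \<open>x\<close> after deleting the edge \<open>{x, y}\<close>. With \<open>A\<close> the branch at
  \<open>x\<close>, \<open>E(A)\<close> is \<open>branch_edges T x y\<close> and \<open>E(B)\<close> is \<open>branch_edges T y x\<close>.\<close>

definition branch_edges :: "'a ugraph \<Rightarrow> 'a \<Rightarrow> 'a \<Rightarrow> 'a set set" where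
  "branch_edges T x y =
     {e \<in> edges T - {{x, y}}. \<forall>u \<in> e. (x, u) \<in> (adj (edges T - {{x, y}}))\<^sup>*}"

definition root_indicator :: "'a \<Rightarrow> 'a set \<Rightarrow> real" where
  "root_indicator x e = (if x \<in> e then 1 else 0)"

definition coupling :: "'a ugraph \<Rightarrow> 'a \<Rightarrow> 'a set \<Rightarrow> real" where
  "coupling T x e = 1 / real (vdegree T x) * root_indicator x e"

definition resolvent_form :: "'a ugraph \<Rightarrow> 'a \<Rightarrow> 'a \<Rightarrow> real \<Rightarrow> real" where
  "resolvent_form T x y lam =
     (let I = branch_edges T x y;
          N = inverse_on I (\<lambda>e f. lam * identity_on e f - ricci T e f)
      in \<Sum>e \<in> I. \<Sum>f \<in> I. coupling T x e * N e f * coupling T x f)"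

text \<open>\<open>\<Phi>\<^sub>A\<close> is \<open>feedback T x y\<close> and \<open>\<Phi>\<^sub>B\<close> is \<open>feedback T y x\<close>.\<close>

definition feedback :: "'a ugraph \<Rightarrow> 'a \<Rightarrow> 'a \<Rightarrow> real \<Rightarrow> real" where
  "feedback T x y lam =
     2 * (lam + 1 / real (vdegree T x) + 1 / 2 - resolvent_form T x y lam)"


section \<open>Transfer matrix and Chebyshev polynomials\<close>

definition transfer_matrix :: "real \<Rightarrow> real mat" where
  "transfer_matrix lam = mat_of_rows_list 2 [[2 * (1 + lam), -1], [1, 0]]"

definition chain_D :: "nat \<Rightarrow> real \<Rightarrow> real \<Rightarrow> real \<Rightarrow> real" where
  "chain_D l lam \<Phi>A \<Phi>B =
     vec_of_list [- \<Phi>B, 1] \<bullet>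
       ((transfer_matrix lam ^\<^sub>m (l - 2)) *\<^sub>v vec_of_list [\<Phi>A, 1])"

text \<open>Chebyshev polynomials of the second kind for indices \<open>n \<ge> -2\<close>; the value at smaller
  indices is irrelevant.\<close>

function chebyshev_U :: "int \<Rightarrow> real \<Rightarrow> real" where
  "chebyshev_U n c =
     (if n \<le> -2 then -1 else if n = -1 then 0 else if n = 0 then 1
      else 2 * c * chebyshev_U (n - 1) c - chebyshev_U (n - 2) c)"
  by auto
termination by (relation "Wellfounded.measure (\<lambda>(n, c). nat (n + 2))") auto

declare chebyshev_U.simps [simp del]

lemma chebyshev_U_init [simp]:
  "chebyshev_U (-2) c = -1" "chebyshev_U (-1) c = 0" "chebyshev_U 0 c = 1"
  by (simp_all add: chebyshev_U.simps)

lemma chebyshev_U_rec: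
  assumes "n \<ge> -1"
  shows "chebyshev_U (n + 1) c = 2 * c * chebyshev_U n c - chebyshev_U (n - 1) c"
  using assms by (cases "n = -1") (simp_all add: chebyshev_U.simps [of "n + 1"])

end

(* On a branch, the eigenvalue equations form a linear system forced only by the value z of the
   eigenvector on the chain edge at the root, so for lam outside the branch spectrum the branch
   values are z times a fixed vector. Eliminating both branches and adding the virtual chain
   values z_0 = (2(1 + lam) - PhiA) z_1 and z_{l+1} = (2(1 + lam) - PhiB) z_l turns every
   remaining equation, for every l >= 1 (in particular for T itself, l = 1), into
   z_{j-1} + z_{j+1} = 2(1 + lam) z_j. Hence z_j = z_1 s_j for the solution s of this recurrence
   with s_0 = 2(1 + lam) - PhiA and s_1 = 1, and the last virtual value is consistent with a
   nonzero z_1 iff s_{l-1} = PhiB s_l. The transfer matrix and the Chebyshev polynomials are two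
   ways of writing s. *)

theory Submission
  imports Defs "Jordan_Normal_Form.Determinant"
begin

section \<open>Bridges of a tree\<close>

text \<open>\<open>is_cycle\<close> asks for distinct vertices, so walks must be made simple. When a
  step returns to a vertex already visited, the path is cut back to that vertex.\<close>

lemma rtrancl_distinct_path:
  assumes "(a, b) \<in> r\<^sup>*"
  shows "\<exists>p. p \<noteq> [] \<and> hd p = a \<and> last p = b \<and> distinct p \<and> successively (\<lambda>u v. (u, v) \<in> r) p"
  using assms
proof (induction rule: rtrancl_induct)
  case base
  show ?case by (rule exI [of _ "[a]"]) simp
next
  case (step b c)
  then obtain p where p: "p \<noteq> []" "hd p = a" "last p = b" "distinct p"
    "successively (\<lambda>u v. (u, v) \<in> r) p" by blast
  show ?case
  proof (cases "c \<in> set p")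
    case True
    then obtain p1 p2 where eq: "p = (p1 @ [c]) @ p2" by (metis append_Cons append_Nil append_assoc split_list)
    with p(5) have "successively (\<lambda>u v. (u, v) \<in> r) (p1 @ [c])"
      using successively_append_iff by blast
    with p(2,4) eq show ?thesis
      by (intro exI [of _ "p1 @ [c]"]) (cases p1; auto)
  next
    case False
    with p step.hyps show ?thesis
      by (intro exI [of _ "p @ [c]"]) (auto simp: successively_append_iff)
  qed
qed

lemma tree_edge_is_bridge:
  assumes "finite_tree T" "{x, y} \<in> edges T"
  shows "(x, y) \<notin> (adj (edges T - {{x, y}}))\<^sup>*"
proof
  assume "(x, y) \<in> (adj (edges T - {{x, y}}))\<^sup>*"
  then obtain p where p: "p \<noteq> []" "hd p = x" "last p = y" "distinct p"
    and path: "successively (\<lambda>u v. (u, v) \<in> adj (edges T - {{x, y}})) p"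
    using rtrancl_distinct_path by metis
  have "card {x, y} = 2"
    using assms by (auto simp: finite_tree_def finite_simple_graph_def)
  then have "x \<noteq> y" by auto
  \<comment> \<open>One vertex would force \<open>x = y\<close>; two vertices would make the path
    use the deleted edge itself.\<close>
  have len: "3 \<le> length p"
  proof (rule ccontr)
    assume "\<not> 3 \<le> length p"
    moreover from p(1) have "0 < length p" by simp
    ultimately have "length p = Suc 0 \<or> length p = Suc (Suc 0)" by linarith
    then show False
      using p path \<open>x \<noteq> y\<close> by (auto simp: length_Suc_conv adj_def)
  qed
  have "{p ! i, p ! (Suc i mod length p)} \<in> edges T" if i: "i < length p" for i
  proof (cases "Suc i < length p")
    case True
    with path show ?thesis by (auto simp: successively_conv_nth adj_def)
  next
    case False
    \<comment> \<open>At the last index the successor wraps around to 0, so the closing edge of the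
      cycle is \<open>{x, y}\<close>.\<close>
    with i have "Suc i = length p" by simp
    then have "p ! i = y" "p ! (Suc i mod length p) = x"
      using p by (auto simp: hd_conv_nth last_conv_nth simp flip: \<open>Suc i = length p\<close>)
    then show ?thesis using assms(2) by (simp add: insert_commute)
  qed
  with len p(4) have "is_cycle T p" by (simp add: is_cycle_def)
  with assms(1) show False by (auto simp: finite_tree_def)
qed

lemma sym_adj: "sym (adj E)"
  by (auto simp: sym_def adj_def insert_commute)

text \<open>A common vertex would be reachable from both roots; as adjacency is symmetric, this
  would join \<open>x\<close> to \<open>y\<close> without the bridge.\<close>

lemma branch_edges_disjoint:
  assumes "finite_tree T" "{x, y} \<in> edges T"
  shows "\<Union>(branch_edges T x y) \<inter> \<Union>(branch_edges T y x) = {}"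
proof -
  let ?r = "adj (edges T - {{x, y}})"
  have "sym (?r\<^sup>*)"
    by (simp add: sym_adj sym_rtrancl)
  then have "False" if "(x, u) \<in> ?r\<^sup>*" "(y, u) \<in> ?r\<^sup>*" for u
    using that tree_edge_is_bridge [OF assms] by (meson symD rtrancl_trans)
  then show ?thesis
    unfolding branch_edges_def insert_commute [of y x] by blast
qed

lemma far_root_notin_branch:
  assumes "finite_tree T" "{x, y} \<in> edges T"
  shows "y \<notin> \<Union>(branch_edges T x y)"
  using tree_edge_is_bridge [OF assms] by (auto simp: branch_edges_def)

text \<open>Follow a walk from \<open>x\<close> in the whole tree: each use of the edge
  \<open>{x, y}\<close> ends at a root, and the rest of the walk stays in one branch.\<close>

lemma branch_edges_cover:
  assumes "finite_tree T" "{x, y} \<in> edges T"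
  shows "edges T - {{x, y}} = branch_edges T x y \<union> branch_edges T y x"
proof
  let ?r = "adj (edges T - {{x, y}})"
  have reach: "(x, u) \<in> ?r\<^sup>* \<or> (y, u) \<in> ?r\<^sup>*" if "(x, u) \<in> (adj (edges T))\<^sup>*" for u
    using that
  proof (induction rule: rtrancl_induct)
    case (step u w)
    show ?case
    proof (cases "{u, w} = {x, y}")
      case True
      then show ?thesis by (auto simp: doubleton_eq_iff)
    next
      case False
      with step.hyps have "(u, w) \<in> ?r" by (auto simp: adj_def)
      with step.IH show ?thesis by (meson rtrancl.rtrancl_into_rtrancl)
    qed
  qed simp
  show "edges T - {{x, y}} \<subseteq> branch_edges T x y \<union> branch_edges T y x"
  proof
    fix e assume e: "e \<in> edges T - {{x, y}}"
    then have "e \<subseteq> verts T" "card e = 2"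
      using assms(1) by (auto simp: finite_tree_def finite_simple_graph_def)
    then obtain u w where uw: "e = {u, w}" by (meson card_2_iff)
    have "x \<in> verts T"
      using assms by (auto simp: finite_tree_def finite_simple_graph_def)
    with \<open>e \<subseteq> verts T\<close> uw assms(1) have "(x, u) \<in> (adj (edges T))\<^sup>*"
      by (auto simp: finite_tree_def connected_graph_def)
    moreover from e uw have "(u, w) \<in> ?r" by (auto simp: adj_def)
    ultimately show "e \<in> branch_edges T x y \<union> branch_edges T y x"
      using reach [of u] e uw
      by (auto simp: branch_edges_def insert_commute [of y x] intro: rtrancl.rtrancl_into_rtrancl)
  qed
qed (auto simp: branch_edges_def insert_commute)

section \<open>Resolvents\<close>

text \<open>Numbering \<open>I\<close> turns \<open>M\<close> into a square matrix \<open>A\<close>.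
  A trivial kernel gives \<open>det A\<close> nonzero, hence a two-sided inverse, which is carried
  back along the numbering.\<close>

lemma inverts_on_exists:
  assumes I: "finite I"
    and inj: "\<And>w. (\<And>i. i \<in> I \<Longrightarrow> (\<Sum>j\<in>I. M i j * w j) = 0) \<Longrightarrow> (\<And>i. i \<in> I \<Longrightarrow> w i = 0)"
  shows "\<exists>N. inverts_on I M N"
proof -
  define n where "n = card I"
  obtain b where b: "bij_betw b {0..<n} I"
    using I ex_bij_betw_nat_finite n_def by blast
  define c where "c = the_inv_into {0..<n} b"
  have bI: "b k \<in> I" if "k < n" for k
    using b that by (auto simp: bij_betw_def)
  have cb: "c (b k) = k" if "k < n" for k
    using b that by (auto simp: c_def bij_betw_def the_inv_into_f_f)
  have c: "c i < n" "b (c i) = i" if "i \<in> I" for i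
    using b that cb by (auto simp: bij_betw_def)
  have sum_I: "(\<Sum>k\<in>I. f k) = (\<Sum>k = 0..<n. f (b k))" for f :: "'a \<Rightarrow> real"
    using sum.reindex_bij_betw [OF b] by metis
  define A where "A = mat n n (\<lambda>(i, j). M (b i) (b j))"
  have A: "A \<in> carrier_mat n n" by (simp add: A_def)
  have "det A \<noteq> 0"
  proof
    assume "det A = 0"
    then obtain u where u: "u \<in> carrier_vec n" "u \<noteq> 0\<^sub>v n" "A *\<^sub>v u = 0\<^sub>v n"
      using det_0_iff_vec_prod_zero_field [OF A] by blast
    have "u $ c i = 0" if "i \<in> I" for i
    proof (rule inj [of "\<lambda>i. u $ c i"])
      fix i assume "i \<in> I"
      then have "(A *\<^sub>v u) $ c i = (\<Sum>k\<in>I. M i k * u $ c k)"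
        using u(1) c by (simp add: A_def scalar_prod_def sum_I cb)
      with u(3) c \<open>i \<in> I\<close> show "(\<Sum>k\<in>I. M i k * u $ c k) = 0" by simp
    qed (fact that)
    then have "u $ k = 0" if "k < n" for k
      using bI cb that by metis
    with u(1,2) show False by (metis carrier_vecD dim_vec eq_vecI index_zero_vec)
  qed
  then obtain B where B: "B \<in> carrier_mat n n" "A * B = 1\<^sub>m n" "B * A = 1\<^sub>m n"
    using det_non_zero_imp_unit [OF A, of "()"]
    by (auto simp: Units_def ring_mat_def)
  have "inverts_on I M (\<lambda>i j. B $$ (c i, c j))"
    unfolding inverts_on_def
  proof (intro ballI conjI)
    fix i j assume ij: "i \<in> I" "j \<in> I"
    have "(c i = c j) = (i = j)" using ij c by metis
    then have id: "1\<^sub>m n $$ (c i, c j) = identity_on i j"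
      using ij c by (simp add: identity_on_def)
    have "(A * B) $$ (c i, c j) = (\<Sum>k\<in>I. M i k * B $$ (c k, c j))"
      using ij c B(1) by (simp add: A_def scalar_prod_def sum_I cb)
    then show "(\<Sum>k\<in>I. M i k * B $$ (c k, c j)) = identity_on i j"
      using B(2) id by simp
    have "(B * A) $$ (c i, c j) = (\<Sum>k\<in>I. B $$ (c i, c k) * M k j)"
      using ij c B(1) by (simp add: A_def scalar_prod_def sum_I cb)
    then show "(\<Sum>k\<in>I. B $$ (c i, c k) * M k j) = identity_on i j"
      using B(3) id by simp
  qed
  then show ?thesis by blast
qed

lemma sum_identity_on:
  assumes "finite I" "i \<in> I"
  shows "(\<Sum>j\<in>I. identity_on i j * f j) = f i"
  using assms by (simp add: identity_on_def if_distrib [of "\<lambda>a. a * _"] cong: if_cong)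

text \<open>A kernel vector of \<open>lam I - M\<close> that is nonzero on \<open>I\<close> would be
  an eigenvector for \<open>lam\<close>. So off the spectrum an inverse exists, and the choice in
  \<open>inverse_on\<close> returns one.\<close>

lemma inverts_on_inverse_on:
  assumes "finite I" "lam \<notin> spectrum_on I M"
  shows "inverts_on I (\<lambda>i j. lam * identity_on i j - M i j)
           (inverse_on I (\<lambda>i j. lam * identity_on i j - M i j))"
proof -
  have trivial_kernel: "w i = 0" if w: "\<And>i. i \<in> I \<Longrightarrow> (\<Sum>j\<in>I. (lam * identity_on i j - M i j) * w j) = 0"
    and i: "i \<in> I" for w i
  proof -
    have "(\<Sum>j\<in>I. M i j * w j) = lam * w i" if "i \<in> I" for i
      using w [OF that] sum_identity_on [OF assms(1) that, of w]
      by (simp add: left_diff_distrib sum_subtractf mult.assoc flip: sum_distrib_left)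
    with assms(2) i show ?thesis by (auto simp: spectrum_on_def eigenvector_on_def)
  qed
  have "\<exists>N. inverts_on I (\<lambda>i j. lam * identity_on i j - M i j) N"
    by (rule inverts_on_exists [OF assms(1)]) (fact trivial_kernel)
  then show ?thesis unfolding inverse_on_def by (rule someI_ex)
qed

text \<open>The system reads \<open>(lam I - M) w = t c\<close>. Solving it uses that
  \<open>N\<close> is a left inverse, checking the solution that \<open>N\<close> is a right
  inverse. Later \<open>t\<close> is the value on the chain edge at the root.\<close>

lemma forced_equation_iff:
  assumes I: "finite I" and N: "inverts_on I (\<lambda>i j. lam * identity_on i j - M i j) N"
  shows "(\<forall>i\<in>I. (\<Sum>j\<in>I. M i j * w j) + c i * t = lam * w i) \<longleftrightarrow>
         (\<forall>i\<in>I. w i = t * (\<Sum>j\<in>I. N i j * c j))"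
proof -
  let ?R = "\<lambda>i j. lam * identity_on i j - M i j"
  have R: "(\<Sum>j\<in>I. ?R i j * u j) = lam * u i - (\<Sum>j\<in>I. M i j * u j)" if "i \<in> I" for i u
    using sum_identity_on [OF I that, of u]
    by (simp add: left_diff_distrib sum_subtractf mult.assoc flip: sum_distrib_left)
  have compose: "(\<Sum>j\<in>I. P i j * (\<Sum>k\<in>I. Q j k * u k)) = u i"
    if "\<forall>i\<in>I. \<forall>k\<in>I. (\<Sum>j\<in>I. P i j * Q j k) = identity_on i k" "i \<in> I" for P Q u i
  proof -
    have "(\<Sum>j\<in>I. P i j * (\<Sum>k\<in>I. Q j k * u k)) = (\<Sum>k\<in>I. (\<Sum>j\<in>I. P i j * Q j k) * u k)"
      by (simp add: sum_distrib_left sum_distrib_right mult.assoc) (rule sum.swap)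
    also have "\<dots> = u i" using that sum_identity_on [OF I, of i u] by simp
    finally show ?thesis .
  qed
  show ?thesis (is "?L \<longleftrightarrow> ?W")
  proof
    assume L: ?L
    show ?W
    proof
      fix i assume i: "i \<in> I"
      have "w i = (\<Sum>j\<in>I. N i j * (\<Sum>k\<in>I. ?R j k * w k))"
        using compose [of N ?R i w] N i by (simp add: inverts_on_def)
      also have "\<dots> = (\<Sum>j\<in>I. N i j * (c j * t))"
      proof (intro sum.cong refl)
        fix j assume j: "j \<in> I"
        with L have "(\<Sum>k\<in>I. M j k * w k) + c j * t = lam * w j" by blast
        with R [OF j, of w] have "(\<Sum>k\<in>I. ?R j k * w k) = c j * t" by linarith
        then show "N i j * (\<Sum>k\<in>I. ?R j k * w k) = N i j * (c j * t)" by (rule arg_cong)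
      qed
      finally show "w i = t * (\<Sum>j\<in>I. N i j * c j)"
        by (simp add: sum_distrib_left mult.commute mult.left_commute)
    qed
  next
    assume W: ?W
    show ?L
    proof
      fix i assume i: "i \<in> I"
      have w: "w j = (\<Sum>k\<in>I. N j k * (t * c k))" if "j \<in> I" for j
        using W that by (simp add: sum_distrib_left mult.left_commute)
      have "lam * w i - (\<Sum>j\<in>I. M i j * w j) = (\<Sum>j\<in>I. ?R i j * w j)"
        using R [OF i] by simp
      also have "\<dots> = (\<Sum>j\<in>I. ?R i j * (\<Sum>k\<in>I. N j k * (t * c k)))"
        by (intro sum.cong refl arg_cong2 [where f = "(*)"] w)
      also have "\<dots> = t * c i"
        using compose [of ?R N i "\<lambda>k. t * c k"] N i by (simp add: inverts_on_def)
      finally show "(\<Sum>j\<in>I. M i j * w j) + c i * t = lam * w i" by (simp add: algebra_simps)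
    qed
  qed
qed

section \<open>The chain recurrence\<close>

text \<open>The start value is chosen so that the term at index 2 is \<open>a\<close>: the boundary
  condition \<open>z_2 = a z_1\<close> becomes the recurrence at index 1.\<close>

fun chain_seq :: "real \<Rightarrow> real \<Rightarrow> nat \<Rightarrow> real" where
  "chain_seq c a 0 = 2 * c - a"
| "chain_seq c a (Suc 0) = 1"
| "chain_seq c a (Suc (Suc n)) = 2 * c * chain_seq c a (Suc n) - chain_seq c a n"

text \<open>The recurrence is determined by two consecutive values, and here both are multiples of
  \<open>z 1\<close>. The equations up to \<open>l\<close> determine one value beyond, at
  \<open>Suc l\<close>.\<close>

lemma chain_seq_unique:
  assumes start: "z 0 = (2 * c - a) * z 1"
    and rec: "\<And>j. 1 \<le> j \<Longrightarrow> j \<le> l \<Longrightarrow> z (j - 1) + z (j + 1) = 2 * c * z j"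
    and "j \<le> Suc l"
  shows "z j = z 1 * chain_seq c a j"
  using \<open>j \<le> Suc l\<close>
proof (induction j rule: induct_nat_012)
  case 0
  with start show ?case by simp
next
  case 1
  then show ?case by simp
next
  case (ge2 n)
  with rec [of "Suc n"] show ?case by (simp add: algebra_simps)
qed

text \<open>Both sides obey the same recurrence and agree for \<open>n = 0\<close> (value 1) and
  \<open>n = 1\<close> (value \<open>a\<close>). The case \<open>n = 0\<close> calls on the extended
  value at index -2.\<close>

lemma chain_seq_chebyshev:
  "chain_seq c a (Suc n) = a * chebyshev_U (int n - 1) c - chebyshev_U (int n - 2) c"
proof (induction n rule: induct_nat_012)
  case (ge2 n)
  have index: "int (Suc (Suc n)) - 2 = int n" "int (Suc (Suc n)) - 1 = int n + 1"
    "int (Suc n) - 2 = int n - 1" "int (Suc n) - 1 = int n"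
    by auto
  have "chebyshev_U (int n) c = 2 * c * chebyshev_U (int n - 1) c - chebyshev_U (int n - 2) c"
    using chebyshev_U_rec [of "int n - 1" c] by simp
  moreover have "chebyshev_U (int n + 1) c =
      2 * c * chebyshev_U (int n) c - chebyshev_U (int n - 1) c"
    by (rule chebyshev_U_rec) simp
  ultimately show ?case
    unfolding chain_seq.simps(3) [of c a "Suc n"] ge2 index by (simp add: right_diff_distrib)
qed simp_all

section \<open>Powers of the transfer matrix\<close>

lemma transfer_matrix_carrier: "transfer_matrix lam \<in> carrier_mat 2 2"
  by (rule carrier_matI) (simp_all add: transfer_matrix_def mat_of_rows_list_def)

lemma transfer_matrix_step:
  "transfer_matrix lam *\<^sub>v vec_of_list [a, b] = vec_of_list [2 * (1 + lam) * a - b, a]"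
proof (rule eq_vecI)
  fix i assume "i < dim_vec (vec_of_list [2 * (1 + lam) * a - b, a])"
  then have "i = 0 \<or> i = 1" by auto
  then show "(transfer_matrix lam *\<^sub>v vec_of_list [a, b]) $ i =
      vec_of_list [2 * (1 + lam) * a - b, a] $ i"
    by (auto simp: transfer_matrix_def mat_of_rows_list_def scalar_prod_def)
qed (simp add: transfer_matrix_def mat_of_rows_list_def)

text \<open>The state is a pair of consecutive terms, later one first, and each factor shifts it by
  one index. The initial state \<open>(a, 1)\<close> holds the terms at indices 2 and 1.\<close>

lemma transfer_matrix_power:
  "transfer_matrix lam ^\<^sub>m k *\<^sub>v vec_of_list [a, 1] =
     vec_of_list [chain_seq (1 + lam) a (Suc (Suc k)), chain_seq (1 + lam) a (Suc k)]"
proof -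
  let ?M = "transfer_matrix lam"
  have power: "?M ^\<^sub>m k \<in> carrier_mat 2 2" for k
    using transfer_matrix_carrier by (rule pow_carrier_mat)
  \<comment> \<open>\<open>^\<^sub>m\<close> adds its new factor on the right, whereas the shift
    acts from the left.\<close>
  have commute: "?M ^\<^sub>m Suc k = ?M * ?M ^\<^sub>m k" for k
  proof (induction k)
    case 0
    show ?case using transfer_matrix_carrier [of lam] by simp
  next
    case (Suc k)
    have "?M ^\<^sub>m Suc (Suc k) = (?M * ?M ^\<^sub>m k) * ?M"
      using Suc by simp
    also have "\<dots> = ?M * (?M ^\<^sub>m k * ?M)"
      by (rule assoc_mult_mat [OF transfer_matrix_carrier power transfer_matrix_carrier])
    finally show ?case by simp
  qed
  show ?thesis
  proof (induction k)
    case 0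
    have "vec_of_list [a, 1] \<in> carrier_vec 2" by (intro carrier_vecI) simp
    then show ?case using transfer_matrix_carrier [of lam] by simp
  next
    case (Suc k)
    have "vec_of_list [a, 1] \<in> carrier_vec 2" by (intro carrier_vecI) simp
    then have "?M ^\<^sub>m Suc k *\<^sub>v vec_of_list [a, 1] = ?M *\<^sub>v (?M ^\<^sub>m k *\<^sub>v vec_of_list [a, 1])"
      unfolding commute using transfer_matrix_carrier power by (intro assoc_mult_mat_vec)
    then show ?case by (simp only: Suc transfer_matrix_step chain_seq.simps)
  qed
qed

text \<open>The row vector \<open>(-b, 1)\<close> measures the failure of the boundary condition
  \<open>z_{l-1} = b z_l\<close> at the far end.\<close>

lemma chain_D_chain_seq:
  assumes "l \<ge> 2"
  shows "chain_D l lam a b = chain_seq (1 + lam) a (l - 1) - b * chain_seq (1 + lam) a l"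
proof -
  have "Suc (Suc (l - 2)) = l" "Suc (l - 2) = l - 1"
    using assms by auto
  then have "transfer_matrix lam ^\<^sub>m (l - 2) *\<^sub>v vec_of_list [a, 1] =
      vec_of_list [chain_seq (1 + lam) a l, chain_seq (1 + lam) a (l - 1)]"
    using transfer_matrix_power [of lam "l - 2" a] by simp
  then show ?thesis
    by (simp add: chain_D_def scalar_prod_def numeral_2_eq_2)
qed

section \<open>Two branches joined by a chain\<close>

text \<open>Only incidence facts about the two branches are kept. Branch \<open>EA\<close> may meet
  the chain in \<open>v 0\<close> alone, and \<open>EB\<close> in \<open>v l\<close> alone. Since
  \<open>l = 1\<close> is allowed, the original tree and all its subdivisions are instances.\<close>

locale branched_chain =
  fixes G :: "'a ugraph" and EA EB :: "'a set set" and v :: "nat \<Rightarrow> 'a" and l :: nat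
  assumes length_pos: "1 \<le> l"
    and edges_eq: "edges G = EA \<union> EB \<union> chain_edge v ` {1..l}"
    and finite_EA: "finite EA" and finite_EB: "finite EB"
    and empty_EA: "{} \<notin> EA" and empty_EB: "{} \<notin> EB"
    and inj: "inj_on v {0..l}"
    and chain_EA: "\<Union>EA \<inter> v ` {1..l} = {}"
    and chain_EB: "\<Union>EB \<inter> v ` {0..<l} = {}"
    and disjoint: "\<Union>EA \<inter> \<Union>EB = {}"
begin

section \<open>Incidences among chain vertices, chain edges and branches\<close>

lemma v_eq_iff [simp]: "i \<le> l \<Longrightarrow> j \<le> l \<Longrightarrow> v i = v j \<longleftrightarrow> i = j"
  using inj by (auto simp: inj_on_def)

lemma v_notin_EA: "e \<in> EA \<Longrightarrow> 0 < i \<Longrightarrow> i \<le> l \<Longrightarrow> v i \<notin> e"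
proof
  assume "e \<in> EA" "0 < i" "i \<le> l" "v i \<in> e"
  then have "v i \<in> \<Union>EA \<inter> v ` {1..l}" by auto
  with chain_EA show False by simp
qed

lemma v_notin_EB: "e \<in> EB \<Longrightarrow> i < l \<Longrightarrow> v i \<notin> e"
proof
  assume "e \<in> EB" "i < l" "v i \<in> e"
  then have "v i \<in> \<Union>EB \<inter> v ` {0..<l}" by auto
  with chain_EB show False by simp
qed

lemma v_in_chain_edge_iff:
  assumes "i \<le> l" "j \<in> {1..l}"
  shows "v i \<in> chain_edge v j \<longleftrightarrow> i = j \<or> Suc i = j"
proof -
  from assms have "v i = v j \<longleftrightarrow> i = j" "v i = v (j - 1) \<longleftrightarrow> i = j - 1"
    by (auto intro!: v_eq_iff)
  with assms show ?thesis by (auto simp: chain_edge_def)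
qed

text \<open>Equal edges contain each other's upper endpoint, so each index equals the other or
  precedes it by one; both can hold only if the indices agree.\<close>

lemma inj_chain_edge: "inj_on (chain_edge v) {1..l}"
proof (rule inj_onI)
  fix i j assume ij: "i \<in> {1..l}" "j \<in> {1..l}" "chain_edge v i = chain_edge v j"
  then have "v i \<in> chain_edge v j" "v j \<in> chain_edge v i"
    by (auto simp: chain_edge_def)
  with ij(1,2) have "i = j \<or> Suc i = j" "j = i \<or> Suc j = i"
    by (simp_all add: v_in_chain_edge_iff)
  then show "i = j" by linarith
qed

text \<open>The upper endpoint \<open>v j\<close> keeps the edge out of \<open>EA\<close>, the lower
  endpoint \<open>v (j - 1)\<close> keeps it out of \<open>EB\<close>.\<close>

lemma chain_edge_notin:
  assumes "j \<in> {1..l}"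
  shows "chain_edge v j \<notin> EA \<union> EB"
proof -
  from assms have "0 < j" "j \<le> l" "j - 1 < l" by auto
  then show ?thesis
    using v_notin_EA [of "chain_edge v j" j] v_notin_EB [of "chain_edge v j" "j - 1"]
    by (auto simp: chain_edge_def)
qed

lemma EA_EB_disjoint: "EA \<inter> EB = {}"
proof (rule ccontr)
  assume "EA \<inter> EB \<noteq> {}"
  then obtain e where "e \<in> EA" "e \<in> EB" by blast
  moreover from this empty_EA have "e \<noteq> {}" by metis
  ultimately show False using disjoint by blast
qed

lemma sum_edges:
  "(\<Sum>f\<in>edges G. h f) = (\<Sum>f\<in>EA. h f) + (\<Sum>f\<in>EB. h f) + (\<Sum>j\<in>{1..l}. h (chain_edge v j))"
  for h :: "'a set \<Rightarrow> real"
proof -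
  have "(EA \<union> EB) \<inter> chain_edge v ` {1..l} = {}"
    using chain_edge_notin by blast
  then show ?thesis
    by (simp add: edges_eq sum.union_disjoint finite_EA finite_EB EA_EB_disjoint
        sum.reindex [OF inj_chain_edge] del: One_nat_def)
qed

section \<open>Reversal of the chain: vertices map by \<open>j\<close> to \<open>l - j\<close>,
  edges by \<open>j\<close> to \<open>Suc l - j\<close>\<close>

lemma chain_edge_reversed:
  "j \<in> {1..l} \<Longrightarrow> chain_edge (\<lambda>j. v (l - j)) j = chain_edge v (Suc l - j)"
  by (auto simp: chain_edge_def insert_commute Suc_diff_le)

text \<open>This symmetry transfers every fact about \<open>EA\<close> and \<open>v 0\<close> to
  \<open>EB\<close> and \<open>v l\<close>.\<close>

lemma reversed: "branched_chain G EB EA (\<lambda>j. v (l - j)) l"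
proof
  have "chain_edge (\<lambda>j. v (l - j)) ` {1..l} = chain_edge v ` (\<lambda>j. Suc l - j) ` {1..l}"
    using chain_edge_reversed by (simp add: image_image cong: image_cong_simp)
  also have "(\<lambda>j. Suc l - j) ` {1..l} = {1..l}"
  proof (intro equalityI subsetI)
    fix j assume "j \<in> {1..l}"
    then show "j \<in> (\<lambda>j. Suc l - j) ` {1..l}"
      by (intro image_eqI [of _ _ "Suc l - j"]) auto
  qed auto
  finally show "edges G = EB \<union> EA \<union> chain_edge (\<lambda>j. v (l - j)) ` {1..l}"
    by (auto simp: edges_eq)
  show "inj_on (\<lambda>j. v (l - j)) {0..l}"
    by (rule inj_onI) auto
  show "\<Union>EB \<inter> (\<lambda>j. v (l - j)) ` {1..l} = {}"
    using v_notin_EB by fastforce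
  show "\<Union>EA \<inter> (\<lambda>j. v (l - j)) ` {0..<l} = {}"
    using v_notin_EA by fastforce
qed (use length_pos finite_EA finite_EB empty_EA empty_EB disjoint in auto)

section \<open>Vertex degrees and rows of the Ricci matrix\<close>

text \<open>The chain adds exactly one edge at \<open>v 0\<close> and none at other branch vertices.
  Hence these degrees depend only on \<open>EA\<close> and \<open>v 0\<close>, whatever the length
  of the chain.\<close>

lemma vdegree_EA:
  assumes "z \<in> insert (v 0) (\<Union>EA)"
  shows "vdegree G z = card {e \<in> EA. z \<in> e} + (if z = v 0 then 1 else 0)"
proof (cases "z = v 0")
  case True
  have "{e \<in> edges G. z \<in> e} = insert (chain_edge v 1) {e \<in> EA. z \<in> e}"
    using True length_pos v_notin_EB [of _ 0] by (auto simp: edges_eq v_in_chain_edge_iff)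
  then show ?thesis
    using True chain_edge_notin [of 1] length_pos finite_EA by (simp add: vdegree_def)
next
  case False
  have "z \<noteq> v j" if "j \<le> l" for j
    using that False assms v_notin_EA [of _ j] by (cases "j = 0") auto
  then have "z \<notin> chain_edge v j" if "j \<in> {1..l}" for j
    using that unfolding chain_edge_def
    by (metis One_nat_def atLeastAtMost_iff diff_le_self insertE le_trans singletonD)
  then have "{e \<in> edges G. z \<in> e} = {e \<in> EA. z \<in> e}"
    using False assms disjoint by (auto simp: edges_eq)
  then show ?thesis
    using False by (simp add: vdegree_def)
qed

lemma vdegree_inner:
  assumes "0 < j" "j < l"
  shows "vdegree G (v j) = 2"
proof -
  have "{e \<in> edges G. v j \<in> e} = {chain_edge v j, chain_edge v (Suc j)}"
    using assms v_notin_EA [of _ j] v_notin_EB [of _ j]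
    by (auto simp: edges_eq v_in_chain_edge_iff)
  moreover have "chain_edge v j \<noteq> chain_edge v (Suc j)"
    using assms inj_onD [OF inj_chain_edge, of j "Suc j"] by auto
  ultimately show ?thesis by (simp add: vdegree_def)
qed

text \<open>A branch edge and a chain edge can share only \<open>v 0\<close>, which lies on the
  first chain edge alone.\<close>

lemma ricci_EA_chain:
  assumes "e \<in> EA" "j \<in> {1..l}"
  shows "ricci G e (chain_edge v j) = (if j = 1 then coupling G (v 0) e else 0)"
    and "ricci G (chain_edge v j) e = (if j = 1 then coupling G (v 0) e else 0)"
proof -
  have "v j \<notin> e" "j = 1 \<or> v (j - 1) \<notin> e"
    using assms v_notin_EA [of e j] v_notin_EA [of e "j - 1"] diff_le_self [of j 1]
    by (auto simp del: diff_le_self)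
  then have "e \<inter> chain_edge v j = (if j = 1 \<and> v 0 \<in> e then {v 0} else {})"
    by (auto simp: chain_edge_def)
  moreover have "e \<noteq> chain_edge v j"
    using assms chain_edge_notin by blast
  ultimately show "ricci G e (chain_edge v j) = (if j = 1 then coupling G (v 0) e else 0)"
    "ricci G (chain_edge v j) e = (if j = 1 then coupling G (v 0) e else 0)"
    by (auto simp: ricci_def coupling_def root_indicator_def Int_commute [of "chain_edge v j" e])
qed

text \<open>The row sees the rest of the graph through one number, the value on the first chain
  edge; this is the forcing term \<open>t\<close> of the branch system.\<close>

lemma row_EA:
  assumes e: "e \<in> EA"
  shows "(\<Sum>f\<in>edges G. ricci G e f * w f) =
    (\<Sum>f\<in>EA. ricci G e f * w f) + coupling G (v 0) e * w (chain_edge v 1)"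
proof -
  have "ricci G e f = 0" if "f \<in> EB" for f
  proof -
    have "e \<inter> f = {}" "e \<noteq> f" using e that disjoint EA_EB_disjoint by blast+
    then show ?thesis by (simp add: ricci_def)
  qed
  moreover have "(\<Sum>j\<in>{1..l}. ricci G e (chain_edge v j) * w (chain_edge v j)) =
      (\<Sum>j\<in>{1..l}. if j = 1 then coupling G (v 0) e * w (chain_edge v j) else 0)"
    by (intro sum.cong refl) (simp add: ricci_EA_chain e)
  ultimately show ?thesis
    using length_pos by (simp add: sum_edges)
qed

lemma ricci_EB_chain:
  assumes "e \<in> EB" "j \<in> {1..l}"
  shows "ricci G (chain_edge v j) e = (if j = l then coupling G (v l) e else 0)"
proof -
  interpret rev: branched_chain G EB EA "\<lambda>j. v (l - j)" l by (rule reversed)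
  have j: "Suc l - j \<in> {1..l}" "Suc l - (Suc l - j) = j" "Suc l - j = 1 \<longleftrightarrow> j = l"
    using assms(2) by auto
  show ?thesis
    using rev.ricci_EA_chain(2) [OF assms(1) j(1)] chain_edge_reversed [OF j(1)]
    by (simp only: j diff_zero)
qed

text \<open>The chain block is tridiagonal, since only consecutive edges meet, in one vertex. As
  \<open>i\<close> is at least 1, the test \<open>i = j - 1\<close> fails for
  \<open>j = 1\<close>.\<close>

lemma ricci_chain_chain:
  assumes "i \<in> {1..l}" "j \<in> {1..l}"
  shows "ricci G (chain_edge v j) (chain_edge v i) =
    (if i = j then - (1 / real (vdegree G (v (j - 1))) + 1 / real (vdegree G (v j)))
     else if i = j - 1 then 1 / real (vdegree G (v (j - 1)))
     else if i = j + 1 then 1 / real (vdegree G (v j)) else 0)"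
proof (cases "i = j")
  case True
  from assms(2) have "v (j - 1) \<noteq> v j" by (subst v_eq_iff) auto
  with True show ?thesis by (simp add: ricci_def chain_edge_def)
next
  case False
  with assms have "chain_edge v j \<noteq> chain_edge v i"
    using inj_onD [OF inj_chain_edge] by blast
  moreover have "chain_edge v j \<inter> chain_edge v i =
      (if i = j - 1 then {v (j - 1)} else if i = j + 1 then {v j} else {})"
    using assms False by (auto simp: chain_edge_def)
  ultimately show ?thesis using False by (simp add: ricci_def)
qed

lemma row_chain:
  fixes w :: "'a set \<Rightarrow> real"
  assumes j: "j \<in> {1..l}"
  defines "r \<equiv> \<lambda>i. 1 / real (vdegree G (v i))" and "z \<equiv> \<lambda>i. w (chain_edge v i)"
  shows "(\<Sum>f\<in>edges G. ricci G (chain_edge v j) f * w f) =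
    (if j = 1 then (\<Sum>f\<in>EA. coupling G (v 0) f * w f) else r (j - 1) * z (j - 1)) +
    (if j = l then (\<Sum>f\<in>EB. coupling G (v l) f * w f) else r j * z (j + 1)) -
    (r (j - 1) + r j) * z j"
proof -
  \<comment> \<open>Written as three delta sums; those at \<open>j - 1 = 0\<close> and
    \<open>j + 1 = l + 1\<close> fall outside the range and vanish.\<close>
  have "(\<Sum>i\<in>{1..l}. ricci G (chain_edge v j) (chain_edge v i) * w (chain_edge v i)) =
      (\<Sum>i\<in>{1..l}. (if i = j then - ((r (j - 1) + r j) * z i) else 0) +
        (if i = j - 1 then r (j - 1) * z i else 0) + (if i = j + 1 then r j * z i else 0))"
    using j by (intro sum.cong refl) (auto simp: ricci_chain_chain r_def z_def left_diff_distrib distrib_right)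
  also have "\<dots> =
      (if j = 1 then 0 else r (j - 1) * z (j - 1)) + (if j = l then 0 else r j * z (j + 1)) -
      (r (j - 1) + r j) * z j"
    using j by (auto simp: sum.distrib)
  finally show ?thesis
    using j by (simp add: sum_edges ricci_EA_chain ricci_EB_chain)
qed

text \<open>With these end values, for \<open>l\<close> at least 2, the recurrence at
  \<open>j = 1\<close> says \<open>z_2 = a z_1\<close> and at \<open>j = l\<close> says
  \<open>z_{l-1} = b z_l\<close>. For \<open>l = 1\<close> both ends fall into one equation,
  \<open>(2c - a - b) z_1 = 0\<close>.\<close>

definition virtual_chain :: "real \<Rightarrow> real \<Rightarrow> real \<Rightarrow> ('a set \<Rightarrow> real) \<Rightarrow> nat \<Rightarrow> real" where
  "virtual_chain c a b w j =
     (if j = 0 then (2 * c - a) * w (chain_edge v 1)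
      else if j = l + 1 then (2 * c - b) * w (chain_edge v l)
      else w (chain_edge v j))"

text \<open>The row splits into halves, one for each endpoint of the edge. An inner endpoint has
  degree 2, which gives the factor 1/2. At a root, the constants in the feedback value make
  \<open>qA - 1 / d\<close> take the same form, with the virtual value as neighbour.\<close>

lemma row_chain_virtual:
  assumes j: "j \<in> {1..l}"
    and a: "a = 2 * (lam + 1 / real (vdegree G (v 0)) + 1 / 2 - qA)"
    and b: "b = 2 * (lam + 1 / real (vdegree G (v l)) + 1 / 2 - qB)"
    and wA: "(\<Sum>f\<in>EA. coupling G (v 0) f * w f) = w (chain_edge v 1) * qA"
    and wB: "(\<Sum>f\<in>EB. coupling G (v l) f * w f) = w (chain_edge v l) * qB"
  defines "h \<equiv> virtual_chain (1 + lam) a b w"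
  shows "(\<Sum>f\<in>edges G. ricci G (chain_edge v j) f * w f) = (h (j - 1) + h (j + 1)) / 2 - h j"
proof -
  let ?r = "\<lambda>i. 1 / real (vdegree G (v i))" and ?z = "\<lambda>i. w (chain_edge v i)"
  have left: "(if j = 1 then \<Sum>f\<in>EA. coupling G (v 0) f * w f else ?r (j - 1) * ?z (j - 1))
      - ?r (j - 1) * ?z j = (h (j - 1) - ?z j) / 2"
  proof (cases "j = 1")
    case True
    moreover have "h 0 = (2 * (1 + lam) - a) * ?z 1" by (simp add: h_def virtual_chain_def)
    ultimately show ?thesis
      using wA by (simp add: a field_simps del: One_nat_def)
  next
    case False
    with j have "vdegree G (v (j - 1)) = 2" by (intro vdegree_inner) auto
    moreover from False j have "h (j - 1) = ?z (j - 1)" by (auto simp: h_def virtual_chain_def)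
    ultimately show ?thesis using False by (simp add: field_simps)
  qed
  have right: "(if j = l then \<Sum>f\<in>EB. coupling G (v l) f * w f else ?r j * ?z (j + 1))
      - ?r j * ?z j = (h (j + 1) - ?z j) / 2"
  proof (cases "j = l")
    case True
    moreover have "h (l + 1) = (2 * (1 + lam) - b) * ?z l" by (simp add: h_def virtual_chain_def)
    ultimately show ?thesis
      using wB by (simp add: b field_simps)
  next
    case False
    with j have "vdegree G (v j) = 2" by (intro vdegree_inner) auto
    moreover from False j have "h (j + 1) = ?z (j + 1)" by (auto simp: h_def virtual_chain_def)
    ultimately show ?thesis using False by (simp add: field_simps)
  qed
  have "h j = ?z j" using j by (auto simp: h_def virtual_chain_def)
  moreover have "(?r (j - 1) + ?r j) * ?z j = ?r (j - 1) * ?z j + ?r j * ?z j"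
    by (rule distrib_right)
  \<comment> \<open>Adding the halves: each contributes \<open>- k / 2\<close>, and together these
    give the term \<open>- h j\<close>.\<close>
  moreover have "L + R - s = (c + d) / 2 - m"
    if "m = k" "s = p + q" "L - p = (c - k) / 2" "R - q = (d - k) / 2" for L R s c d m k p q :: real
    using that by (simp add: field_simps)
  ultimately show ?thesis
    unfolding row_chain [OF j] using left right by blast
qed

end

text \<open>The solvability assumptions encode \<open>lam \<notin> \<sigma>(R\<^sub>A) \<union> \<sigma>(R\<^sub>B)\<close>, with
  \<open>gA = (lam I - R\<^sub>A)\<^sup>-\<^sup>1 c\<^sub>A\<close> and \<open>gB = (lam I - R\<^sub>B)\<^sup>-\<^sup>1 c\<^sub>B\<close>; \<open>a\<close> and \<open>b\<close> are
  the feedback values.\<close>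

locale solved_branched_chain = branched_chain +
  fixes lam a b :: real and gA gB :: "'a set \<Rightarrow> real"
  assumes solve_EA: "(\<forall>e\<in>EA. (\<Sum>f\<in>EA. ricci G e f * w f) + coupling G (v 0) e * t = lam * w e)
      \<longleftrightarrow> (\<forall>e\<in>EA. w e = t * gA e)"
    and solve_EB: "(\<forall>e\<in>EB. (\<Sum>f\<in>EB. ricci G e f * w f) + coupling G (v l) e * t = lam * w e)
      \<longleftrightarrow> (\<forall>e\<in>EB. w e = t * gB e)"
    and a_eq: "a = 2 * (lam + 1 / real (vdegree G (v 0)) + 1 / 2 -
      (\<Sum>e\<in>EA. coupling G (v 0) e * gA e))"
    and b_eq: "b = 2 * (lam + 1 / real (vdegree G (v l)) + 1 / 2 -
      (\<Sum>e\<in>EB. coupling G (v l) e * gB e))"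
begin

lemma row_EB:
  assumes "e \<in> EB"
  shows "(\<Sum>f\<in>edges G. ricci G e f * w f) =
    (\<Sum>f\<in>EB. ricci G e f * w f) + coupling G (v l) e * w (chain_edge v l)"
proof -
  interpret rev: branched_chain G EB EA "\<lambda>j. v (l - j)" l by (rule reversed)
  show ?thesis
    using rev.row_EA [OF assms, of w] chain_edge_reversed [of 1] length_pos by simp
qed

text \<open>The branch rows are forced systems whose \<open>t\<close> is the adjacent chain value.
  Their solutions turn the branch sums in the chain rows into the resolvent terms of
  \<open>a\<close> and \<open>b\<close>.\<close>

lemma eigen_equations_iff:
  fixes w :: "'a set \<Rightarrow> real"
  defines "h \<equiv> virtual_chain (1 + lam) a b w"
  shows "(\<forall>e\<in>edges G. (\<Sum>f\<in>edges G. ricci G e f * w f) = lam * w e) \<longleftrightarrow>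
    (\<forall>e\<in>EA. w e = w (chain_edge v 1) * gA e) \<and> (\<forall>e\<in>EB. w e = w (chain_edge v l) * gB e) \<and>
    (\<forall>j\<in>{1..l}. h (j - 1) + h (j + 1) = 2 * (1 + lam) * h j)"
    (is "?L \<longleftrightarrow> ?A \<and> ?B \<and> ?C")
proof -
  let ?row = "\<lambda>e. (\<Sum>f\<in>edges G. ricci G e f * w f)"
  have "?L \<longleftrightarrow> (\<forall>e\<in>EA. ?row e = lam * w e) \<and> (\<forall>e\<in>EB. ?row e = lam * w e) \<and>
      (\<forall>j\<in>{1..l}. ?row (chain_edge v j) = lam * w (chain_edge v j))"
    by (subst (1) edges_eq) blast
  also have "(\<forall>e\<in>EA. ?row e = lam * w e) \<longleftrightarrow> ?A"
    unfolding solve_EA [symmetric] by (simp add: row_EA)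
  also have "(\<forall>e\<in>EB. ?row e = lam * w e) \<longleftrightarrow> ?B"
    unfolding solve_EB [symmetric] by (simp add: row_EB)
  also have "?A \<and> ?B \<and> (\<forall>j\<in>{1..l}. ?row (chain_edge v j) = lam * w (chain_edge v j)) \<longleftrightarrow>
      ?A \<and> ?B \<and> ?C"
  \<comment> \<open>The chain rows match the recurrence only given the branch solutions, so the
    equivalence is proved under \<open>?A\<close> and \<open>?B\<close>.\<close>
  proof (intro conj_cong refl ball_cong)
    fix j assume A: ?A and B: ?B and j: "j \<in> {1..l}"
    have "?row (chain_edge v j) = (h (j - 1) + h (j + 1)) / 2 - h j"
      unfolding h_def
    proof (rule row_chain_virtual [OF j a_eq b_eq])
      show "(\<Sum>f\<in>EA. coupling G (v 0) f * w f) =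
          w (chain_edge v 1) * (\<Sum>e\<in>EA. coupling G (v 0) e * gA e)"
        unfolding sum_distrib_left using A by (intro sum.cong refl) simp
      show "(\<Sum>f\<in>EB. coupling G (v l) f * w f) =
          w (chain_edge v l) * (\<Sum>e\<in>EB. coupling G (v l) e * gB e)"
        unfolding sum_distrib_left using B by (intro sum.cong refl) simp
    qed
    moreover have "h j = w (chain_edge v j)"
      using j by (auto simp: h_def virtual_chain_def)
    ultimately show "?row (chain_edge v j) = lam * w (chain_edge v j) \<longleftrightarrow>
        h (j - 1) + h (j + 1) = 2 * (1 + lam) * h j"
      by (simp add: field_simps) argo
  qed
  finally show ?thesis .
qed

text \<open>The first two claims are the recurrence at the ends, with the virtual value eliminated;
  \<open>l\<close> at least 2 makes the other neighbour a genuine chain edge.\<close>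

lemma eigenvector_chain:
  assumes w: "eigenvector_on (edges G) (ricci G) lam w" and l: "l \<ge> 2"
  shows "w (chain_edge v 2) = a * w (chain_edge v 1)"
    and "w (chain_edge v (l - 1)) = b * w (chain_edge v l)"
    and "2 \<le> j \<Longrightarrow> j \<le> l - 1 \<Longrightarrow>
      w (chain_edge v (j - 1)) + w (chain_edge v (j + 1)) = 2 * (1 + lam) * w (chain_edge v j)"
proof -
  let ?h = "virtual_chain (1 + lam) a b w"
  have rec: "?h (j - 1) + ?h (j + 1) = 2 * (1 + lam) * ?h j" if "j \<in> {1..l}" for j
    using w eigen_equations_iff [of w] that by (auto simp: eigenvector_on_def)
  show "w (chain_edge v 2) = a * w (chain_edge v 1)"
    using rec [of 1] l by (simp add: virtual_chain_def algebra_simps numeral_2_eq_2)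
  show "w (chain_edge v (l - 1)) = b * w (chain_edge v l)"
  proof -
    have "l \<in> {1..l}" "l - 1 \<noteq> 0" "l - 1 \<noteq> l + 1" "l \<noteq> 0" "l \<noteq> l + 1" "l + 1 \<noteq> 0"
      using l by auto
    with rec [of l] show ?thesis by (simp add: virtual_chain_def left_diff_distrib)
  qed
  show "w (chain_edge v (j - 1)) + w (chain_edge v (j + 1)) = 2 * (1 + lam) * w (chain_edge v j)"
    if "2 \<le> j" "j \<le> l - 1"
  proof -
    have "j \<in> {1..l}" "j - 1 \<noteq> 0" "j - 1 \<noteq> l + 1" "j \<noteq> 0" "j \<noteq> l + 1" "j + 1 \<noteq> l + 1"
      using that by auto
    then show ?thesis using rec [of j] by (simp add: virtual_chain_def)
  qed
qed

text \<open>The term at \<open>l + 1\<close> is fixed twice, by the recurrence and by the virtual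
  end value. For the normalised sequence the two differ by \<open>?D\<close> up to sign.\<close>

lemma spectrum_iff:
  "lam \<in> spectrum_on (edges G) (ricci G) \<longleftrightarrow>
     chain_seq (1 + lam) a (l - 1) - b * chain_seq (1 + lam) a l = 0"
    (is "_ \<longleftrightarrow> ?D = 0")
proof
  let ?s = "chain_seq (1 + lam) a"
  have next_s: "?s (l + 1) = 2 * (1 + lam) * ?s l - ?s (l - 1)"
    using length_pos by (cases l) simp_all
  {
    assume "lam \<in> spectrum_on (edges G) (ricci G)"
    then obtain w where nz: "\<exists>e\<in>edges G. w e \<noteq> 0"
      and eqs: "\<forall>e\<in>edges G. (\<Sum>f\<in>edges G. ricci G e f * w f) = lam * w e"
      by (auto simp: spectrum_on_def eigenvector_on_def)
    define h where "h = virtual_chain (1 + lam) a b w"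
    let ?z = "w (chain_edge v 1)"
    have A: "\<forall>e\<in>EA. w e = ?z * gA e" and B: "\<forall>e\<in>EB. w e = w (chain_edge v l) * gB e"
      and rec: "h (j - 1) + h (j + 1) = 2 * (1 + lam) * h j" if "j \<in> {1..l}" for j
      using eqs unfolding eigen_equations_iff h_def using that by blast+
    have h1: "h 0 = (2 * (1 + lam) - a) * h 1" "h 1 = ?z"
      using length_pos by (auto simp: h_def virtual_chain_def)
    have h: "h j = ?z * ?s j" if "j \<le> Suc l" for j
      using chain_seq_unique [of h "1 + lam" a l j] rec h1 that by simp
    have chain: "w (chain_edge v j) = ?z * ?s j" if "j \<in> {1..l}" for j
      using h [of j] that by (auto simp: h_def virtual_chain_def)
    \<comment> \<open>If \<open>z_1\<close> vanished, so would the whole chain, and then both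
      branches, being multiples of its end values.\<close>
    have "?z \<noteq> 0"
    proof
      assume z: "?z = 0"
      then have "w (chain_edge v j) = 0" if "j \<in> {1..l}" for j
        using chain [OF that] by simp
      with A B z length_pos have "\<forall>e\<in>edges G. w e = 0" by (auto simp: edges_eq)
      with nz show False by blast
    qed
    have "h (l + 1) = (2 * (1 + lam) - b) * (?z * ?s l)"
      using chain [of l] length_pos by (simp add: h_def virtual_chain_def)
    with h [of "l + 1"] have "?z * (?s (l + 1) - (2 * (1 + lam) - b) * ?s l) = 0"
      by (simp add: algebra_simps)
    with \<open>?z \<noteq> 0\<close> have "?s (l + 1) - (2 * (1 + lam) - b) * ?s l = 0"
      by (metis mult_eq_0_iff)
    then show "?D = 0"
      unfolding next_s by (simp add: algebra_simps)
  }
  {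
    assume D: "?D = 0"
    \<comment> \<open>The eigenvector normalised by \<open>z_1 = 1\<close>: the sequence on the
      chain, and on each branch the fixed solution scaled by the adjacent chain value.\<close>
    define w where "w e = (if e \<in> EA then gA e else if e \<in> EB then ?s l * gB e
      else ?s (the_inv_into {1..l} (chain_edge v) e))" for e
    have chain: "w (chain_edge v j) = ?s j" if "j \<in> {1..l}" for j
      using chain_edge_notin [OF that] the_inv_into_f_f [OF inj_chain_edge that]
      by (simp add: w_def)
    have ends: "w (chain_edge v 1) = 1" "w (chain_edge v l) = ?s l"
      using chain [of 1] chain [of l] length_pos by auto
    \<comment> \<open>At \<open>j = l + 1\<close> this is exactly where \<open>?D = 0\<close>
      enters.\<close>
    have h: "virtual_chain (1 + lam) a b w j = ?s j" if "j \<le> l + 1" for j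
      using that chain [of j] next_s D ends
      by (auto simp: virtual_chain_def algebra_simps)
    have "\<forall>e\<in>edges G. (\<Sum>f\<in>edges G. ricci G e f * w f) = lam * w e"
      unfolding eigen_equations_iff
    proof (intro conjI ballI)
      fix e assume "e \<in> EA"
      then show "w e = w (chain_edge v 1) * gA e" by (simp only: ends) (simp add: w_def)
    next
      fix e assume "e \<in> EB"
      with EA_EB_disjoint have "e \<notin> EA" by blast
      with \<open>e \<in> EB\<close> show "w e = w (chain_edge v l) * gB e"
        by (simp only: ends) (simp add: w_def)
    next
      fix j assume j: "j \<in> {1..l}"
      then have "?s (j - 1) + ?s (j + 1) = 2 * (1 + lam) * ?s j"
        by (cases j) simp_all
      moreover have "j - 1 \<le> l + 1" "j + 1 \<le> l + 1" "j \<le> l + 1" using j by auto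
      ultimately show "virtual_chain (1 + lam) a b w (j - 1) + virtual_chain (1 + lam) a b w (j + 1) =
          2 * (1 + lam) * virtual_chain (1 + lam) a b w j"
        by (simp only: h)
    qed
    moreover have "chain_edge v 1 \<in> edges G"
      using length_pos by (auto simp: edges_eq)
    ultimately show "lam \<in> spectrum_on (edges G) (ricci G)"
      using ends unfolding spectrum_on_def eigenvector_on_def
      by (intro CollectI exI [of _ w] conjI bexI [of _ "chain_edge v 1"]) simp_all
  }
qed

end

section \<open>Subdivided trees\<close>

text \<open>Here \<open>g\<close> is the resolvent applied to the coupling vector, so pairing it
  with that vector gives \<open>resolvent_form\<close>. Exchanging \<open>x\<close> and
  \<open>y\<close> serves the other branch.\<close>

lemma feedback_solution:
  assumes "finite_tree T" "lam \<notin> spectrum_on (branch_edges T x y) (ricci T)"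
  shows "\<exists>g.
    (\<forall>w t. (\<forall>e\<in>branch_edges T x y.
        (\<Sum>f\<in>branch_edges T x y. ricci T e f * w f) + coupling T x e * t = lam * w e)
      \<longleftrightarrow> (\<forall>e\<in>branch_edges T x y. w e = t * g e)) \<and>
    feedback T x y lam = 2 * (lam + 1 / real (vdegree T x) + 1 / 2 -
      (\<Sum>e\<in>branch_edges T x y. coupling T x e * g e))"
proof -
  let ?I = "branch_edges T x y"
  let ?N = "inverse_on ?I (\<lambda>e f. lam * identity_on e f - ricci T e f)"
  have "edges T \<subseteq> Pow (verts T)" "finite (verts T)"
    using assms(1) by (auto simp: finite_tree_def finite_simple_graph_def)
  then have "finite (edges T)" by (meson finite_Pow_iff finite_subset)
  then have I: "finite ?I"
    by (rule rev_finite_subset) (auto simp: branch_edges_def)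
  show ?thesis
  proof (intro exI [of _ "\<lambda>e. \<Sum>f\<in>?I. ?N e f * coupling T x f"] conjI allI)
    show "feedback T x y lam = 2 * (lam + 1 / real (vdegree T x) + 1 / 2 -
        (\<Sum>e\<in>?I. coupling T x e * (\<Sum>f\<in>?I. ?N e f * coupling T x f)))"
      by (simp add: feedback_def resolvent_form_def Let_def sum_distrib_left mult.assoc)
  qed (rule forced_equation_iff [OF I inverts_on_inverse_on [OF I assms(2)]])
qed

text \<open>The bridge property separates the branches and keeps each away from the opposite root;
  freshness of the inner vertices gives the remaining incidence conditions.\<close>

lemma branched_chain_subdivide:
  assumes tree: "finite_tree T" and edge: "{x, y} \<in> edges T"
    and l: "1 \<le> l" and path: "subdividing_path T x y l v"
  shows "branched_chain (subdivide T x y l v) (branch_edges T x y) (branch_edges T y x) v l"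
proof
  let ?A = "branch_edges T x y" and ?B = "branch_edges T y x"
  have graph: "finite (verts T)" "\<And>e. e \<in> edges T \<Longrightarrow> e \<subseteq> verts T \<and> card e = 2"
    using tree by (auto simp: finite_tree_def finite_simple_graph_def)
  have ends: "v 0 = x" "v l = y" and inner: "inj_on v {1..<l}" "v ` {1..<l} \<inter> verts T = {}"
    using path by (auto simp: subdividing_path_def)
  have xy: "x \<noteq> y" "x \<in> verts T" "y \<in> verts T"
    using graph(2) [OF edge] by auto
  have sub: "?A \<subseteq> edges T" "?B \<subseteq> edges T"
    by (auto simp: branch_edges_def)
  have "finite (edges T)"
    using graph by (meson Pow_iff finite_Pow_iff finite_subset subsetI)
  with sub show "finite ?A" "finite ?B" by (auto intro: finite_subset)
  show "{} \<notin> ?A" "{} \<notin> ?B" using sub graph(2) [of "{}"] by auto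
  show "edges (subdivide T x y l v) = ?A \<union> ?B \<union> chain_edge v ` {1..l}"
    using branch_edges_cover [OF tree edge] by (simp add: subdivide_def)
  show "\<Union>?A \<inter> \<Union>?B = {}" by (rule branch_edges_disjoint [OF tree edge])
  have AB_verts: "\<Union>?A \<subseteq> verts T" "\<Union>?B \<subseteq> verts T"
    using sub graph(2) by blast+
  have far: "y \<notin> \<Union>?A" "x \<notin> \<Union>?B"
    using far_root_notin_branch tree edge by (metis insert_commute)+
  have inner_disjoint: "X \<inter> v ` {1..<l} = {}" if "X \<subseteq> verts T" for X
    using that inner(2) by blast
  have "{1..l} = insert l {1..<l}" "{0..<l} = insert 0 {1..<l}"
    using l by auto
  then have "v ` {1..l} = insert y (v ` {1..<l})" "v ` {0..<l} = insert x (v ` {1..<l})"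
    using ends by auto
  with far show "\<Union>?A \<inter> v ` {1..l} = {}" "\<Union>?B \<inter> v ` {0..<l} = {}"
    using AB_verts [THEN inner_disjoint] by (simp_all only: Int_insert_right if_False)
  show "inj_on v {0..l}"
  proof -
    have "{0..l} = insert 0 (insert l {1..<l})" using l by auto
    moreover have "x \<notin> v ` {1..<l}" "y \<notin> v ` {1..<l}"
      using xy(2,3) inner(2) by auto
    ultimately show ?thesis
      using inner(1) ends xy(1) by (auto simp: inj_on_insert)
  qed
qed (fact l)

text \<open>Entries within a branch involve only degrees at branch vertices, which \<open>EA\<close>
  and the root determine. So the blocks formed with degrees of \<open>T\<close> are also those of
  every subdivision.\<close>

lemma branched_chain_ricci_eq:
  assumes "branched_chain G EA EB v l" "branched_chain G' EA EB' v' l'" "v 0 = v' 0"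
    and "e \<in> EA" "f \<in> EA"
  shows "ricci G e f = ricci G' e f"
proof -
  have "vdegree G z = vdegree G' z" if "z \<in> e" for z
  proof -
    from that assms(4) have "z \<in> insert (v 0) (\<Union>EA)" by blast
    with branched_chain.vdegree_EA [OF assms(1)] branched_chain.vdegree_EA [OF assms(2)] assms(3)
    show ?thesis by simp
  qed
  then show ?thesis by (auto simp: ricci_def intro!: sum.cong)
qed

text \<open>Feedback and regularity refer to \<open>T\<close>, the locale to the subdivided graph.
  Viewing \<open>T\<close> as a chain of length 1 with the same branches identifies degrees,
  couplings and branch blocks.\<close>

lemma solved_branched_chain_subdivide:
  assumes tree: "finite_tree T" and edge: "{x, y} \<in> edges T"
    and regular: "lam \<notin> spectrum_on (branch_edges T x y) (ricci T)
                       \<union> spectrum_on (branch_edges T y x) (ricci T)"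
    and l: "1 \<le> l" and path: "subdividing_path T x y l v"
  shows "\<exists>gA gB. solved_branched_chain (subdivide T x y l v) (branch_edges T x y)
    (branch_edges T y x) v l lam (feedback T x y lam) (feedback T y x lam) gA gB"
proof -
  let ?G = "subdivide T x y l v" and ?A = "branch_edges T x y" and ?B = "branch_edges T y x"
  interpret branched_chain ?G ?A ?B v l
    by (rule branched_chain_subdivide [OF tree edge l path])
  define u where "u i = (if i = 0 then x else y)" for i :: nat
  have u: "subdividing_path T x y 1 u" by (simp add: subdividing_path_def u_def)
  have T: "branched_chain T ?A ?B u 1"
    using branched_chain_subdivide [OF tree edge _ u] subdivide_1 [OF u edge] by simp
  \<comment> \<open>Both chains reversed have root \<open>y\<close> at index 0, which yields the
    comparison for the second branch.\<close>
  note revs = reversed branched_chain.reversed [OF T]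
  have ends: "v 0 = x" "v l = y" "u 0 = x" "u 1 = y"
    using path by (auto simp: subdividing_path_def u_def)
  have degrees: "vdegree ?G x = vdegree T x" "vdegree ?G y = vdegree T y"
    using vdegree_EA [of x] branched_chain.vdegree_EA [OF T, of x]
      branched_chain.vdegree_EA [OF revs(1), of y] branched_chain.vdegree_EA [OF revs(2), of y] ends
    by simp_all
  have ricci: "ricci ?G e f = ricci T e f" if "e \<in> ?A \<and> f \<in> ?A \<or> e \<in> ?B \<and> f \<in> ?B" for e f
    using that branched_chain_ricci_eq [OF branched_chain_axioms T, of e f]
      branched_chain_ricci_eq [OF revs, of e f] ends by auto
  have coupling: "coupling ?G x = coupling T x" "coupling ?G y = coupling T y"
    by (simp_all add: coupling_def degrees fun_eq_iff)
  have rows: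
    "e \<in> ?A \<Longrightarrow> (\<Sum>f\<in>?A. ricci ?G e f * w f) = (\<Sum>f\<in>?A. ricci T e f * w f)"
    "e \<in> ?B \<Longrightarrow> (\<Sum>f\<in>?B. ricci ?G e f * w f) = (\<Sum>f\<in>?B. ricci T e f * w f)" for e w
    by (auto simp: ricci intro!: sum.cong)
  from regular have reg: "lam \<notin> spectrum_on ?A (ricci T)" "lam \<notin> spectrum_on ?B (ricci T)" by auto
  obtain gA where A:
    "\<And>w t. (\<forall>e\<in>?A. (\<Sum>f\<in>?A. ricci T e f * w f) + coupling T x e * t = lam * w e)
      \<longleftrightarrow> (\<forall>e\<in>?A. w e = t * gA e)"
    "feedback T x y lam = 2 * (lam + 1 / real (vdegree T x) + 1 / 2 -
      (\<Sum>e\<in>?A. coupling T x e * gA e))"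
    using feedback_solution [OF tree reg(1)] by blast
  obtain gB where B:
    "\<And>w t. (\<forall>e\<in>?B. (\<Sum>f\<in>?B. ricci T e f * w f) + coupling T y e * t = lam * w e)
      \<longleftrightarrow> (\<forall>e\<in>?B. w e = t * gB e)"
    "feedback T y x lam = 2 * (lam + 1 / real (vdegree T y) + 1 / 2 -
      (\<Sum>e\<in>?B. coupling T y e * gB e))"
    using feedback_solution [OF tree reg(2)] by blast
  have "solved_branched_chain ?G ?A ?B v l lam (feedback T x y lam) (feedback T y x lam) gA gB"
  proof
    fix w t
    show "(\<forall>e\<in>?A. (\<Sum>f\<in>?A. ricci ?G e f * w f) + coupling ?G (v 0) e * t = lam * w e)
        \<longleftrightarrow> (\<forall>e\<in>?A. w e = t * gA e)"
      unfolding ends coupling A(1) [symmetric] by (simp add: rows)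
    show "(\<forall>e\<in>?B. (\<Sum>f\<in>?B. ricci ?G e f * w f) + coupling ?G (v l) e * t = lam * w e)
        \<longleftrightarrow> (\<forall>e\<in>?B. w e = t * gB e)"
      unfolding ends coupling B(1) [symmetric] by (simp add: rows)
  qed (simp_all only: ends coupling degrees A(2) B(2))
  then show ?thesis by blast
qed

theorem proposition3:
  fixes T :: "'a ugraph" and x y :: 'a and lam \<Phi>A \<Phi>B :: real
  assumes tree: "finite_tree T"
    and edge: "{x, y} \<in> edges T"
    and regular: "lam \<notin> spectrum_on (branch_edges T x y) (ricci T)
                       \<union> spectrum_on (branch_edges T y x) (ricci T)"
    and PhiA: "\<Phi>A = feedback T x y lam"
    and PhiB: "\<Phi>B = feedback T y x lam"
  shows "(\<forall>l v w. l \<ge> 2 \<longrightarrow> subdividing_path T x y l v \<longrightarrow>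
             eigenvector_on (edges (subdivide T x y l v)) (ricci (subdivide T x y l v)) lam w \<longrightarrow>
             (let z = (\<lambda>j. w (chain_edge v j))
              in z 2 = \<Phi>A * z 1 \<and> z (l - 1) = \<Phi>B * z l \<and>
                 (\<forall>j. 2 \<le> j \<and> j \<le> l - 1 \<longrightarrow> z (j - 1) + z (j + 1) = 2 * (1 + lam) * z j)))
       \<and> (lam \<in> spectrum_on (edges T) (ricci T) \<longleftrightarrow> 2 * (1 + lam) - \<Phi>A - \<Phi>B = 0)
       \<and> (\<forall>l \<ge> 2.
             (\<forall>v. subdividing_path T x y l v \<longrightarrow>
                (lam \<in> spectrum_on (edges (subdivide T x y l v)) (ricci (subdivide T x y l v))
                   \<longleftrightarrow> chain_D l lam \<Phi>A \<Phi>B = 0))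
             \<and> chain_D l lam \<Phi>A \<Phi>B =
                 - \<Phi>A * \<Phi>B * chebyshev_U (int l - 2) (1 + lam)
                 + (\<Phi>A + \<Phi>B) * chebyshev_U (int l - 3) (1 + lam)
                 - chebyshev_U (int l - 4) (1 + lam))
       \<and> chain_D 2 lam \<Phi>A \<Phi>B = 1 - \<Phi>A * \<Phi>B
       \<and> chain_D 3 lam \<Phi>A \<Phi>B = \<Phi>A + \<Phi>B - 2 * (1 + lam) * \<Phi>A * \<Phi>B"
proof (intro conjI allI impI)
  have solved: "\<exists>gA gB. solved_branched_chain (subdivide T x y l v) (branch_edges T x y)
      (branch_edges T y x) v l lam \<Phi>A \<Phi>B gA gB"
    if "1 \<le> l" "subdividing_path T x y l v" for l v
    unfolding PhiA PhiB by (rule solved_branched_chain_subdivide [OF tree edge regular that])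
  fix l :: nat
  {
    fix v w
    assume l: "2 \<le> l" and path: "subdividing_path T x y l v"
      and w: "eigenvector_on (edges (subdivide T x y l v)) (ricci (subdivide T x y l v)) lam w"
    from solved [OF _ path] l obtain gA gB where
      "solved_branched_chain (subdivide T x y l v) (branch_edges T x y)
        (branch_edges T y x) v l lam \<Phi>A \<Phi>B gA gB" by auto
    from solved_branched_chain.eigenvector_chain [OF this w l]
    show "let z = (\<lambda>j. w (chain_edge v j))
      in z 2 = \<Phi>A * z 1 \<and> z (l - 1) = \<Phi>B * z l \<and>
         (\<forall>j. 2 \<le> j \<and> j \<le> l - 1 \<longrightarrow> z (j - 1) + z (j + 1) = 2 * (1 + lam) * z j)"
      unfolding Let_def by blast
  }
  {
    fix v
    assume l: "2 \<le> l" and path: "subdividing_path T x y l v"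
    from solved [OF _ path] l obtain gA gB where
      "solved_branched_chain (subdivide T x y l v) (branch_edges T x y)
        (branch_edges T y x) v l lam \<Phi>A \<Phi>B gA gB" by auto
    from solved_branched_chain.spectrum_iff [OF this]
    show "lam \<in> spectrum_on (edges (subdivide T x y l v)) (ricci (subdivide T x y l v))
        \<longleftrightarrow> chain_D l lam \<Phi>A \<Phi>B = 0"
      by (simp only: chain_D_chain_seq [OF l])
  }
  show "chain_D l lam \<Phi>A \<Phi>B =
      - \<Phi>A * \<Phi>B * chebyshev_U (int l - 2) (1 + lam)
      + (\<Phi>A + \<Phi>B) * chebyshev_U (int l - 3) (1 + lam)
      - chebyshev_U (int l - 4) (1 + lam)" if l: "2 \<le> l"
  proof -
    from l obtain n where n: "l = Suc (Suc n)" by (metis Suc_le_D numeral_2_eq_2 Suc_le_mono)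
    have "chain_seq (1 + lam) \<Phi>A l =
        \<Phi>A * chebyshev_U (int l - 2) (1 + lam) - chebyshev_U (int l - 3) (1 + lam)"
      using chain_seq_chebyshev [of "1 + lam" \<Phi>A "Suc n"] by (simp add: n)
    moreover have "chain_seq (1 + lam) \<Phi>A (l - 1) =
        \<Phi>A * chebyshev_U (int l - 3) (1 + lam) - chebyshev_U (int l - 4) (1 + lam)"
      using chain_seq_chebyshev [of "1 + lam" \<Phi>A n] by (simp add: n)
    ultimately show ?thesis
      by (simp only: chain_D_chain_seq [OF l]) (simp add: left_diff_distrib right_diff_distrib distrib_right)
  qed
  \<comment> \<open>The unsubdivided tree is the chain of length 1, where the criterion reads
    \<open>s_0 - b s_1 = 0\<close> with \<open>s_0 = 2(1 + lam) - a\<close> and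
    \<open>s_1 = 1\<close>.\<close>
  define u where "u i = (if i = 0 then x else y)" for i :: nat
  have u: "subdividing_path T x y 1 u" by (simp add: subdividing_path_def u_def)
  with solved obtain gA gB where
    "solved_branched_chain (subdivide T x y 1 u) (branch_edges T x y)
      (branch_edges T y x) u 1 lam \<Phi>A \<Phi>B gA gB" by blast
  from solved_branched_chain.spectrum_iff [OF this]
  show "lam \<in> spectrum_on (edges T) (ricci T) \<longleftrightarrow> 2 * (1 + lam) - \<Phi>A - \<Phi>B = 0"
    unfolding subdivide_1 [OF u edge] by simp
  \<comment> \<open>From \<open>s_1 = 1\<close>, \<open>s_2 = a\<close> and
    \<open>s_3 = 2(1 + lam) a - 1\<close>, with \<open>a\<close> and \<open>b\<close> the two
    feedback values.\<close>
  show "chain_D 2 lam \<Phi>A \<Phi>B = 1 - \<Phi>A * \<Phi>B"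
    "chain_D 3 lam \<Phi>A \<Phi>B = \<Phi>A + \<Phi>B - 2 * (1 + lam) * \<Phi>A * \<Phi>B"
    by (simp_all add: chain_D_chain_seq numeral_2_eq_2 numeral_3_eq_3 algebra_simps)
qed

end
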